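(* Let $\mathcal B_{\mathcal S}$ be the set of partitions $\beta_1+\cdots+\beta_n$ ($0<\beta_1\le\cdots\le\beta_n$) with $\beta_1\in\{1,2,3\}$ and, for each $2\le i\le n$: if $3\nmid\beta_i$ then $3\le\beta_i-\beta_{i-1}\le5$, and if $3\mid\beta_i$ then $4\le\beta_i-\beta_{i-1}\le6$. For a partition $\beta$ let $w(\beta)=u^{a(\beta)}v^{c(\beta)}q^{|\beta|}$, where $a(\beta)$ is the number of parts congruent to $0$ or $1$ mod $3$ and $c(\beta)$ is the number of parts congruent to $0$ or $2$ mod $3$. Let $b_{\mathcal S}(n)=\sum w(\beta)$ over $\beta\in\mathcal B_{\mathcal S}$ with exactly $n$ parts ($b_{\mathcal S}(0)=1$). Then, as formal power series in $q$ with coefficients polynomials in $u,v$, $$\sum_{n\ge0}\frac{b_{\mathcal S}(n)}{(q^3;q^3)_n}=(-uq;q^3)_\infty(-vq^2;q^3)_\infty=\prod_{j\ge1}(1+uq^{3j-2})(1+vq^{3j-1}).$$ Equivalently, the sum of $w(\pi)$ over all partitions $\pi$ whose consecutive parts differ by at least $3$, with difference at least $4$ whenever one of the two parts is divisible by $3$, equals $\prod_{j\ge1}(1+uq^{3j-2})(1+vq^{3j-1})$.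
   Context: $(a;q)_n=\prod_{j=0}^{n-1}(1-aq^j)$, $(a;q)_\infty=\prod_{j\ge0}(1-aq^j)$, $|\beta|$ is the sum of the parts. *)

theory Defs
  imports "HOL-Analysis.Analysis" "HOL-Computational_Algebra.Formal_Power_Series"
begin

text \<open>Partitions are represented as lists of parts in nondecreasing order
  (beta_1 \<le> ... \<le> beta_n, list index i corresponds to beta_(i+1)).\<close>

definition in_BS :: "nat list \<Rightarrow> bool" where
  "in_BS \<beta> \<longleftrightarrow> sorted \<beta> \<and> (\<forall>x\<in>set \<beta>. 0 < x) \<and>
     (\<beta> \<noteq> [] \<longrightarrow> \<beta> ! 0 \<in> {1,2,3}) \<and>
     (\<forall>i. 1 \<le> i \<and> i < length \<beta> \<longrightarrow>
        (\<not> 3 dvd \<beta> ! i \<longrightarrow> 3 \<le> \<beta> ! i - \<beta> ! (i-1) \<and> \<beta> ! i - \<beta> ! (i-1) \<le> 5) \<and>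
        (3 dvd \<beta> ! i \<longrightarrow> 4 \<le> \<beta> ! i - \<beta> ! (i-1) \<and> \<beta> ! i - \<beta> ! (i-1) \<le> 6))"

definition cnt_a :: "nat list \<Rightarrow> nat" where
  "cnt_a \<beta> = length (filter (\<lambda>x. x mod 3 = 0 \<or> x mod 3 = 1) \<beta>)"

definition cnt_c :: "nat list \<Rightarrow> nat" where
  "cnt_c \<beta> = length (filter (\<lambda>x. x mod 3 = 0 \<or> x mod 3 = 2) \<beta>)"

definition bS :: "'a::comm_ring_1 \<Rightarrow> 'a \<Rightarrow> nat \<Rightarrow> 'a fps" where
  "bS u v n = Abs_fps (\<lambda>N. \<Sum>\<beta>\<in>{\<beta>. in_BS \<beta> \<and> length \<beta> = n \<and> sum_list \<beta> = N}.
       u ^ cnt_a \<beta> * v ^ cnt_c \<beta>)"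

definition q3poch :: "nat \<Rightarrow> 'a::comm_ring_1 fps" where
  "q3poch n = (\<Prod>j<n. 1 - fps_X ^ (3 * (j + 1)))"

end

theory Submission
  imports Defs
begin

text \<open>
  Deleting the first part \<open>r \<in> {1,2,3}\<close> of a base partition and lowering the remaining parts by
  a gap of 3 or 6, which depends only on \<open>r\<close> and the new first part, leaves a base partition
  with one part fewer.  This gives a three-term recurrence for \<open>b\<^sub>S(n)\<close>.  The coefficients
  \<open>C\<^sub>n\<close> of \<open>e(uz) e(vqz) E(uvq\<^sup>2z)\<close>, where \<open>e\<close> and \<open>E\<close> are the two q-exponentials in
  base \<open>q\<^sup>3\<close>, satisfy the matching recurrence, because the product satisfies a functional
  equation under \<open>z \<mapsto> q\<^sup>3z\<close>; hence \<open>b\<^sub>S(n)/(q\<^sup>3;q\<^sup>3)\<^sub>n = q^(n + 3 tri n) C\<^sub>n\<close>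
  with \<open>tri n = n(n-1)/2\<close>.
  Summed over \<open>n\<close> and regrouped with the q-Chu-Vandermonde identity, this becomes the product
  of the Euler sums for \<open>(-uq;q\<^sup>3)\<^sub>\<infinity>\<close> and \<open>(-vq\<^sup>2;q\<^sup>3)\<^sub>\<infinity>\<close>.  Everything is proved coefficientwise
  up to an arbitrary order \<open>N\<close>, which is what convergence of formal power series means.
\<close>

no_notation vec_nth (infixl \<open>$\<close> 90)
notation fps_nth (infixl \<open>$\<close> 75)

section \<open>q-binomial coefficients\<close>

fun tri :: "nat \<Rightarrow> nat" where
  "tri 0 = 0"
| "tri (Suc n) = tri n + n"

lemma tri_add: "tri (a + b) = tri a + tri b + a * b"
  by (induction b) (simp_all add: algebra_simps)

definition qpoch :: "'a::comm_ring_1 \<Rightarrow> nat \<Rightarrow> 'a" where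
  "qpoch q n = (\<Prod>j<n. 1 - q ^ Suc j)"

definition qfall :: "'a::comm_ring_1 \<Rightarrow> nat \<Rightarrow> nat \<Rightarrow> 'a" where
  "qfall q l k = (\<Prod>r<k. 1 - q ^ (l - r))"

fun qbinom :: "'a::comm_ring_1 \<Rightarrow> nat \<Rightarrow> nat \<Rightarrow> 'a" where
  "qbinom q 0 k = (if k = 0 then 1 else 0)"
| "qbinom q (Suc m) 0 = 1"
| "qbinom q (Suc m) (Suc k) = qbinom q m k + q ^ Suc k * qbinom q m (Suc k)"

lemma qpoch_0 [simp]: "qpoch q 0 = 1"
  by (simp add: qpoch_def)

lemma qpoch_Suc: "qpoch q (Suc n) = qpoch q n * (1 - q ^ Suc n)"
  by (simp add: qpoch_def)

lemma qbinom_0_right [simp]: "qbinom q m 0 = 1"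
  by (cases m) auto

lemma qbinom_eq_0: "m < k \<Longrightarrow> qbinom q m k = 0"
proof (induction m arbitrary: k)
  case (Suc m)
  then show ?case by (cases k) auto
qed simp

lemma qbinom_diag [simp]: "qbinom q m m = 1"
  by (induction m) (auto simp: qbinom_eq_0)

lemma qbinom_mult_qpoch:
  "k \<le> m \<Longrightarrow> qbinom q m k * qpoch q k * qpoch q (m - k) = qpoch q m"
proof (induction m arbitrary: k)
  case (Suc m)
  show ?case
  proof (cases k)
    case (Suc k')
    show ?thesis
    proof (cases "k' = m")
      case True
      then show ?thesis using Suc by (simp add: qbinom_eq_0 qpoch_Suc)
    next
      case False
      with Suc Suc.prems have "k' < m" by simp
      then obtain d where m: "m = Suc (k' + d)"
        using less_imp_Suc_add by blast
      have IH1: "qbinom q m k' * qpoch q k' * qpoch q (Suc d) = qpoch q m"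
        using Suc.IH[of k'] m by simp
      have IH2: "qbinom q m (Suc k') * qpoch q (Suc k') * qpoch q d = qpoch q m"
        using Suc.IH[of "Suc k'"] m by simp
      have "qbinom q (Suc m) k * qpoch q k * qpoch q (Suc m - k)
          = (qbinom q m k' + q ^ Suc k' * qbinom q m (Suc k'))
            * (qpoch q k' * (1 - q ^ Suc k')) * (qpoch q d * (1 - q ^ Suc d))"
        using Suc m by (simp add: qpoch_Suc)
      also have "\<dots> = (qbinom q m k' * qpoch q k' * qpoch q (Suc d)) * (1 - q ^ Suc k')
            + q ^ Suc k' * (qbinom q m (Suc k') * qpoch q (Suc k') * qpoch q d)
              * (1 - q ^ Suc d)"
        by (simp add: qpoch_Suc algebra_simps)
      also have "\<dots> = qpoch q m * (1 - q ^ Suc k' * q ^ Suc d)"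
        unfolding IH1 IH2 by (simp add: algebra_simps)
      also have "\<dots> = qpoch q (Suc m)"
        by (simp add: qpoch_Suc m power_add mult_ac)
      finally show ?thesis .
    qed
  qed simp
qed simp

lemma qfall_Suc: "qfall q (Suc l) (Suc k) = (1 - q ^ Suc l) * qfall q l k"
  unfolding qfall_def by (subst prod.lessThan_Suc_shift) simp

lemma qfall_eq_0: "l < k \<Longrightarrow> qfall q l k = 0"
  unfolding qfall_def by (rule prod_zero) (auto intro!: bexI[of _ l])

lemma qfall_mult_qpoch: "k \<le> l \<Longrightarrow> qfall q l k * qpoch q (l - k) = qpoch q l"
proof (induction l arbitrary: k)
  case (Suc l)
  show ?case
  proof (cases k)
    case (Suc k')
    then have "qfall q (Suc l) k * qpoch q (Suc l - k) = (1 - q ^ Suc l) * (qfall q l k' * qpoch q (l - k'))"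
      by (simp add: qfall_Suc)
    then show ?thesis
      using Suc.IH[of k'] Suc Suc.prems by (simp add: qpoch_Suc mult.commute)
  qed (simp add: qfall_def)
qed (simp add: qfall_def)

lemma q_vandermonde_shift:
  assumes "k < m"
  shows "q ^ ((m - k) * (l - Suc k)) * q ^ Suc k * qfall q l (Suc k)
       = q ^ l * q ^ ((m - Suc k) * (l - Suc k)) * qfall q l (Suc k)"
proof (cases "Suc k \<le> l")
  case True
  have "m - k = Suc (m - Suc k)"
    using assms by simp
  then have "(m - k) * (l - Suc k) + Suc k = (l - Suc k) + Suc k + (m - Suc k) * (l - Suc k)"
    by simp
  also have "\<dots> = l + (m - Suc k) * (l - Suc k)"
    using True by simp
  finally show ?thesis
    by (metis power_add)
qed (simp add: qfall_eq_0)

lemma q_vandermonde: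
  "(\<Sum>k\<le>m. q ^ ((m - k) * (l - k)) * qbinom q m k * qfall q l k) = 1"
proof (induction m arbitrary: l)
  case (Suc m)
  define W where "W m l = (\<Sum>k\<le>m. q ^ ((m - k) * (l - k)) * qbinom q m k * qfall q l k)" for m l
  define S1 where "S1 = (\<Sum>k\<le>m. q ^ ((m - k) * (l - Suc k)) * qbinom q m k * qfall q l (Suc k))"
  define S2 where "S2 = (\<Sum>k\<le>m. q ^ ((m - k) * (l - Suc k)) * (q ^ Suc k * qbinom q m (Suc k))
                          * qfall q l (Suc k))"
  have IH: "W m l' = 1" for l'
    using Suc.IH by (simp add: W_def)
  have split: "W (Suc m) l = q ^ (Suc m * l) + S1 + S2"
    unfolding W_def S1_def S2_def
    by (simp only: sum.atMost_Suc_shift qbinom.simps distrib_left distrib_right sum.distrib)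
       (simp add: qfall_def mult.assoc)
  have S2: "q ^ (Suc m * l) + S2 = q ^ l * W m l"
  proof -
    have "W m l = q ^ (m * l)
        + (\<Sum>k<m. q ^ ((m - Suc k) * (l - Suc k)) * qbinom q m (Suc k) * qfall q l (Suc k))"
      unfolding W_def by (subst sum.atMost_shift) (simp add: qfall_def)
    moreover have "S2 = (\<Sum>k<m. q ^ l * (q ^ ((m - Suc k) * (l - Suc k))
                                   * qbinom q m (Suc k) * qfall q l (Suc k)))"
    proof -
      have "q ^ ((m - k) * (l - Suc k)) * (q ^ Suc k * qbinom q m (Suc k)) * qfall q l (Suc k)
          = q ^ l * (q ^ ((m - Suc k) * (l - Suc k)) * qbinom q m (Suc k) * qfall q l (Suc k))"
        if "k < m" for k
      proof -
        have "q ^ ((m - k) * (l - Suc k)) * (q ^ Suc k * qbinom q m (Suc k)) * qfall q l (Suc k)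
            = (q ^ ((m - k) * (l - Suc k)) * q ^ Suc k * qfall q l (Suc k)) * qbinom q m (Suc k)"
          by (simp only: mult_ac)
        also have "\<dots> = (q ^ l * q ^ ((m - Suc k) * (l - Suc k)) * qfall q l (Suc k)) * qbinom q m (Suc k)"
          by (simp only: q_vandermonde_shift[OF that])
        finally show ?thesis
          by (simp only: mult_ac)
      qed
      then show ?thesis
        unfolding S2_def lessThan_Suc_atMost[symmetric]
        by (simp add: qbinom_eq_0)
    qed
    ultimately show ?thesis
      by (simp add: distrib_left sum_distrib_left power_add)
  qed
  have S1: "S1 = (if l = 0 then 0 else (1 - q ^ l) * W m (l - 1))"
    by (cases l) (simp_all add: S1_def W_def qfall_Suc qfall_eq_0 sum_distrib_left mult_ac)
  have "W (Suc m) l = 1"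
    using split S1 S2 IH by (cases "l = 0") (simp_all add: algebra_simps)
  then show ?case by (simp add: W_def)
qed (simp add: qfall_def)

theorem q_binomial_theorem:
  "(\<Prod>j<M. 1 + y * q ^ j) = (\<Sum>m\<le>M. y ^ m * q ^ tri m * qbinom q M m)"
proof (induction M arbitrary: y)
  case (Suc M)
  let ?t = "\<lambda>m. y ^ Suc m * q ^ tri (Suc m)"
  have "(\<Prod>j<Suc M. 1 + y * q ^ j) = (1 + y) * (\<Prod>j<M. 1 + (y * q) * q ^ j)"
    by (subst prod.lessThan_Suc_shift) (simp add: mult_ac)
  also have "\<dots> = (\<Sum>m\<le>M. y ^ m * q ^ (m + tri m) * qbinom q M m)
                 + (\<Sum>m\<le>M. ?t m * qbinom q M m)"
    unfolding Suc.IH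
    by (simp add: distrib_right sum_distrib_left power_mult_distrib power_add mult_ac sum.distrib)
  also have "(\<Sum>m\<le>M. y ^ m * q ^ (m + tri m) * qbinom q M m)
      = 1 + (\<Sum>m\<le>M. ?t m * (q ^ Suc m * qbinom q M (Suc m)))"
    by (subst sum.atMost_shift)
       (simp add: lessThan_Suc_atMost[symmetric] qbinom_eq_0 power_add mult_ac del: tri.simps(2))
  also have "1 + (\<Sum>m\<le>M. ?t m * (q ^ Suc m * qbinom q M (Suc m))) + (\<Sum>m\<le>M. ?t m * qbinom q M m)
      = 1 + (\<Sum>m\<le>M. ?t m * qbinom q (Suc M) (Suc m))"
    by (simp add: sum.distrib[symmetric] algebra_simps del: tri.simps)
  also have "\<dots> = (\<Sum>m\<le>Suc M. y ^ m * q ^ tri m * qbinom q (Suc M) m)"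
    by (simp only: sum.atMost_Suc_shift) simp
  finally show ?case .
qed simp

section \<open>Agreement of power series up to a given order\<close>

definition eq_upto :: "nat \<Rightarrow> 'a::comm_ring_1 fps \<Rightarrow> 'a fps \<Rightarrow> bool" where
  "eq_upto N f g \<longleftrightarrow> (\<forall>n\<le>N. f $ n = g $ n)"

lemma eq_upto_refl [simp]: "eq_upto N f f"
  by (simp add: eq_upto_def)

lemma eq_upto_sym: "eq_upto N f g \<Longrightarrow> eq_upto N g f"
  by (simp add: eq_upto_def)

lemma eq_upto_trans: "eq_upto N f g \<Longrightarrow> eq_upto N g h \<Longrightarrow> eq_upto N f h"
  by (simp add: eq_upto_def)

lemma eq_upto_add: "eq_upto N f g \<Longrightarrow> eq_upto N f' g' \<Longrightarrow> eq_upto N (f + f') (g + g')"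
  by (simp add: eq_upto_def)

lemma eq_upto_mult: "eq_upto N f g \<Longrightarrow> eq_upto N f' g' \<Longrightarrow> eq_upto N (f * f') (g * g')"
  unfolding eq_upto_def fps_mult_nth by (auto intro!: sum.cong)

lemma eq_upto_sum:
  "(\<And>i. i \<in> A \<Longrightarrow> eq_upto N (f i) (g i)) \<Longrightarrow> eq_upto N (sum f A) (sum g A)"
  by (simp add: eq_upto_def fps_sum_nth)

lemma eq_upto_prod:
  "(\<And>i. i \<in> A \<Longrightarrow> eq_upto N (f i) (g i)) \<Longrightarrow> eq_upto N (prod f A) (prod g A)"
  by (induction A rule: infinite_finite_induct) (simp_all add: eq_upto_mult)

lemma eq_upto_X_power_mult: "N < d \<Longrightarrow> eq_upto N (fps_X ^ d * f) 0"
  by (simp add: eq_upto_def fps_X_power_mult_nth)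

lemma eq_upto_sum_tail:
  assumes "\<And>i. i \<in> B \<Longrightarrow> eq_upto N (f i) 0" "finite B" "A \<inter> B = {}"
  shows "eq_upto N (sum f (A \<union> B)) (sum f A)"
proof (cases "finite A")
  case True
  have "eq_upto N (sum f A + sum f B) (sum f A + sum (\<lambda>_. 0) B)"
    by (intro eq_upto_add eq_upto_sum assms(1)) simp
  then show ?thesis
    using True assms(2,3) by (simp add: sum.union_disjoint)
qed (use assms(2) in simp)

lemma tendsto_fps_eq_upto:
  assumes "\<And>N. eventually (\<lambda>m. eq_upto N (f m) (P N)) sequentially"
  shows "f \<longlonglongrightarrow> Abs_fps (\<lambda>N. P N $ N)"
proof (rule tendsto_fpsI)
  fix N
  show "eventually (\<lambda>m. f m $ N = Abs_fps (\<lambda>N. P N $ N) $ N) sequentially"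
    using assms[of N] by eventually_elim (simp add: eq_upto_def)
qed

section \<open>Euler's identity and the q-exponentials in base \<open>q\<^sup>3\<close>\<close>

lemma q3poch_eq_qpoch: "q3poch n = qpoch (fps_X ^ 3) n"
  unfolding q3poch_def qpoch_def power_mult[symmetric] by simp

lemma q3poch_Suc: "q3poch (Suc n) = q3poch n * (1 - fps_X ^ (3 * Suc n))"
  by (simp add: q3poch_def)

lemma q3poch_0 [simp]: "q3poch 0 = 1"
  by (simp add: q3poch_def)

lemma q3poch_nth_0 [simp]: "q3poch n $ 0 = (1::'a::comm_ring_1)"
  by (induction n) (simp_all add: q3poch_def)

abbreviation q3inv :: "nat \<Rightarrow> 'a::field fps" where
  "q3inv n \<equiv> inverse (q3poch n)"

lemma q3inv_mult_q3poch [simp]: "q3inv n * q3poch n = 1"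
  by (rule inverse_mult_eq_1) simp

lemma q3poch_mult_q3inv [simp]: "q3poch n * q3inv n = 1"
  by (subst mult.commute) simp

lemma q3inv_Suc: "q3inv (Suc n) * (1 - fps_X ^ (3 * Suc n)) = q3inv n"
proof -
  have "q3inv (Suc n) * (1 - fps_X ^ (3 * Suc n))
      = q3inv (Suc n) * (1 - fps_X ^ (3 * Suc n)) * (q3poch n * q3inv n)"
    by simp
  also have "\<dots> = q3inv (Suc n) * q3poch (Suc n) * q3inv n"
    by (simp only: q3poch_Suc mult_ac)
  finally show ?thesis
    by simp
qed

lemma qbinom_X3:
  assumes "k \<le> m"
  shows "qbinom (fps_X ^ 3) m k = q3poch m * q3inv k * q3inv (m - k)"
proof -
  have "qbinom (fps_X ^ 3) m k
      = qbinom (fps_X ^ 3) m k * (q3poch k * q3inv k) * (q3poch (m - k) * q3inv (m - k))"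
    by simp
  also have "\<dots> = (qbinom (fps_X ^ 3) m k * q3poch k * q3poch (m - k)) * q3inv k * q3inv (m - k)"
    by (simp only: mult_ac)
  also have "\<dots> = q3poch m * q3inv k * q3inv (m - k)"
    by (simp only: qbinom_mult_qpoch[OF assms, of "fps_X ^ 3", folded q3poch_eq_qpoch])
  finally show ?thesis .
qed

lemma qfall_X3:
  assumes "k \<le> l"
  shows "qfall (fps_X ^ 3) l k = q3poch l * q3inv (l - k)"
proof -
  have "qfall (fps_X ^ 3) l k = (qfall (fps_X ^ 3) l k * q3poch (l - k)) * q3inv (l - k)"
    by (simp add: mult.assoc)
  also have "\<dots> = q3poch l * q3inv (l - k)"
    by (simp only: qfall_mult_qpoch[OF assms, of "fps_X ^ 3", folded q3poch_eq_qpoch])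
  finally show ?thesis .
qed

lemma q_vandermonde_X3:
  "(\<Sum>k\<le>min m l. fps_X ^ (3 * ((m - k) * (l - k))) * q3inv (m - k) * q3inv (l - k) * q3inv k)
     = q3inv m * q3inv l"
proof -
  let ?t = "\<lambda>k. fps_X ^ (3 * ((m - k) * (l - k))) * q3inv (m - k) * q3inv (l - k) * q3inv k"
  have "1 = (\<Sum>k\<le>m. (fps_X ^ 3) ^ ((m - k) * (l - k)) * qbinom (fps_X ^ 3) m k * qfall (fps_X ^ 3) l k)"
    by (rule q_vandermonde[symmetric])
  also have "\<dots> = (\<Sum>k\<le>min m l. (fps_X ^ 3) ^ ((m - k) * (l - k)) * qbinom (fps_X ^ 3) m k * qfall (fps_X ^ 3) l k)"
    by (rule sum.mono_neutral_right) (auto simp: qfall_eq_0 min_def split: if_splits)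
  also have "\<dots> = (\<Sum>k\<le>min m l. q3poch m * q3poch l * ?t k)"
    by (rule sum.cong) (auto simp: qbinom_X3 qfall_X3 mult_ac simp flip: power_mult)
  finally have inv: "q3poch m * q3poch l * sum ?t {..min m l} = 1"
    by (simp add: sum_distrib_left)
  have "sum ?t {..min m l} = (q3inv m * q3poch m) * (q3inv l * q3poch l) * sum ?t {..min m l}"
    by simp
  also have "\<dots> = q3inv m * q3inv l * (q3poch m * q3poch l * sum ?t {..min m l})"
    by (simp only: mult_ac)
  finally show ?thesis
    by (simp only: inv mult_1_right)
qed

lemma qbinom_X3_eq_upto:
  assumes "m \<le> N" "2 * N < M"
  shows "eq_upto N (qbinom (fps_X ^ 3) M m) (q3inv m)"
proof -
  have fall: "eq_upto N (qfall (fps_X ^ 3 :: 'a fps) M m) (\<Prod>r<m. 1)"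
    unfolding qfall_def
  proof (intro eq_upto_prod)
    fix r assume "r \<in> {..<m}"
    then have "N < 3 * (M - r)"
      using assms by simp
    then show "eq_upto N (1 - (fps_X ^ 3) ^ (M - r)) 1"
      using eq_upto_X_power_mult[of N "3 * (M - r)" 1]
      by (simp add: eq_upto_def flip: power_mult)
  qed
  have "qbinom (fps_X ^ 3 :: 'a fps) M m = qfall (fps_X ^ 3) M m * q3inv m"
    using assms by (simp add: qbinom_X3 qfall_X3 mult_ac)
  moreover have "eq_upto N (qfall (fps_X ^ 3 :: 'a fps) M m * q3inv m) ((\<Prod>r<m. 1) * q3inv m)"
    by (rule eq_upto_mult[OF fall eq_upto_refl])
  ultimately show ?thesis
    by simp
qed

lemma euler_truncation:
  fixes c :: "'a::field"
  assumes "1 \<le> s" "2 * N < M"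
  shows "eq_upto N (\<Prod>j<M. 1 + fps_const c * fps_X ^ (s + 3 * j))
                   (\<Sum>m\<le>N. fps_const (c ^ m) * fps_X ^ (s * m + 3 * tri m) * q3inv m)"
proof -
  define y q where "y = fps_const c * fps_X ^ s" and "q = (fps_X ^ 3 :: 'a fps)"
  define t where "t m = y ^ m * q ^ tri m * qbinom q M m" for m
  have yq: "y ^ m * q ^ tri m = fps_const (c ^ m) * fps_X ^ (s * m + 3 * tri m)" for m
    by (simp add: y_def q_def power_mult_distrib power_add mult.commute
        flip: power_mult)
  have "(\<Prod>j<M. 1 + fps_const c * fps_X ^ (s + 3 * j)) = (\<Prod>j<M. 1 + y * q ^ j)"
    by (simp add: y_def q_def power_add mult.assoc flip: power_mult)
  also have "\<dots> = sum t {..M}"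
    unfolding q_binomial_theorem t_def ..
  also have "{..M} = {..N} \<union> {N<..M}"
    using assms(2) by auto
  finally have prod_eq: "(\<Prod>j<M. 1 + fps_const c * fps_X ^ (s + 3 * j)) = sum t ({..N} \<union> {N<..M})" .
  have "eq_upto N (t m) 0" if "N < m" for m
  proof -
    have "m \<le> s * m"
      using assms(1) by simp
    then have "N < s * m + 3 * tri m"
      using that by linarith
    moreover have "t m = fps_X ^ (s * m + 3 * tri m) * (fps_const (c ^ m) * qbinom q M m)"
      unfolding t_def yq by (simp only: mult_ac)
    ultimately show ?thesis
      by (simp only: eq_upto_X_power_mult)
  qed
  then have "eq_upto N (sum t ({..N} \<union> {N<..M})) (sum t {..N})"
    by (intro eq_upto_sum_tail) auto
  moreover have "eq_upto N (t m) (fps_const (c ^ m) * fps_X ^ (s * m + 3 * tri m) * q3inv m)"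
    if "m \<le> N" for m
    unfolding t_def yq using qbinom_X3_eq_upto[OF that assms(2)]
    by (intro eq_upto_mult eq_upto_refl) (simp add: q_def)
  then have "eq_upto N (sum t {..N}) (\<Sum>m\<le>N. fps_const (c ^ m) * fps_X ^ (s * m + 3 * tri m) * q3inv m)"
    by (intro eq_upto_sum) simp
  ultimately show ?thesis
    unfolding prod_eq by (rule eq_upto_trans)
qed

text \<open>
  In \<open>'a fps fps\<close> the inner variable is \<open>q = fps_X\<close> and the outer one is an auxiliary
  variable \<open>z\<close>: \<open>q3dilate\<close> substitutes \<open>q\<^sup>3z\<close> for \<open>z\<close>, and \<open>qexp c\<close>, \<open>qExp c\<close> are
  \<open>\<Sum> c\<^sup>n z\<^sup>n/(q\<^sup>3;q\<^sup>3)\<^sub>n\<close> and \<open>\<Sum> q^(3 tri n) c\<^sup>n z\<^sup>n/(q\<^sup>3;q\<^sup>3)\<^sub>n\<close>.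
\<close>

definition q3dilate :: "'a::comm_ring_1 fps fps \<Rightarrow> 'a fps fps" where
  "q3dilate F = F oo (fps_const (fps_X ^ 3) * fps_X)"

lemma q3dilate_nth [simp]: "q3dilate F $ n = fps_X ^ (3 * n) * F $ n"
  by (simp add: q3dilate_def power_mult)

lemma q3dilate_mult: "q3dilate (F * G) = q3dilate F * (q3dilate G :: 'a::idom fps fps)"
  by (simp add: q3dilate_def fps_compose_mult_distrib)

definition qexp :: "'a::field fps \<Rightarrow> 'a fps fps" where
  "qexp c = Abs_fps (\<lambda>n. c ^ n * q3inv n)"

definition qExp :: "'a::field fps \<Rightarrow> 'a fps fps" where
  "qExp c = Abs_fps (\<lambda>n. c ^ n * fps_X ^ (3 * tri n) * q3inv n)"

lemma qexp_functional_equation: "qexp c * (1 - fps_const c * fps_X) = q3dilate (qexp c)"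
proof (rule fps_ext)
  fix n
  show "(qexp c * (1 - fps_const c * fps_X)) $ n = q3dilate (qexp c) $ n"
  proof (cases n)
    case (Suc k)
    have "(qexp c * (1 - fps_const c * fps_X)) $ Suc k = c ^ Suc k * q3inv (Suc k) - c ^ Suc k * q3inv k"
      by (simp add: qexp_def algebra_simps)
    also have "\<dots> = c ^ Suc k * q3inv (Suc k) - c ^ Suc k * (q3inv (Suc k) * (1 - fps_X ^ (3 * Suc k)))"
      by (simp only: q3inv_Suc)
    also have "\<dots> = q3dilate (qexp c) $ Suc k"
      by (simp add: qexp_def algebra_simps)
    finally show ?thesis
      using Suc by simp
  qed (simp add: qexp_def)
qed

lemma qExp_functional_equation: "qExp c = (1 + fps_const c * fps_X) * q3dilate (qExp c)"
proof (rule fps_ext)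
  fix n
  show "qExp c $ n = ((1 + fps_const c * fps_X) * q3dilate (qExp c)) $ n"
  proof (cases n)
    case (Suc k)
    have "((1 + fps_const c * fps_X) * q3dilate (qExp c)) $ Suc k
        = fps_X ^ (3 * Suc k) * (c ^ Suc k * fps_X ^ (3 * tri (Suc k)) * q3inv (Suc k))
          + c * (fps_X ^ (3 * k) * (c ^ k * fps_X ^ (3 * tri k) * q3inv k))"
      by (simp add: qExp_def distrib_right mult.assoc)
    also have "\<dots> = c ^ Suc k * fps_X ^ (3 * tri (Suc k))
          * (fps_X ^ (3 * Suc k) * q3inv (Suc k) + q3inv k)"
      by (simp add: algebra_simps flip: power_add)
    also have "\<dots> = c ^ Suc k * fps_X ^ (3 * tri (Suc k))
          * (fps_X ^ (3 * Suc k) * q3inv (Suc k) + q3inv (Suc k) * (1 - fps_X ^ (3 * Suc k)))"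
      by (simp only: q3inv_Suc)
    also have "\<dots> = qExp c $ Suc k"
      by (simp add: qExp_def algebra_simps del: tri.simps)
    finally show ?thesis
      using Suc by simp
  qed (simp add: qExp_def)
qed

lemma three_term_recurrence:
  fixes F :: "'a::comm_ring_1 fps fps"
  assumes "F * (1 - fps_const a * fps_X) * (1 - fps_const b * fps_X)
            = (1 + fps_const e * fps_X) * q3dilate F"
  shows "F $ 1 * (1 - fps_X ^ 3) = (a + b + e) * F $ 0"
    and "F $ Suc (Suc n) * (1 - fps_X ^ (3 * Suc (Suc n)))
           = (a + b + e * fps_X ^ (3 * Suc n)) * F $ Suc n - a * b * F $ n"
proof -
  have "F * (1 - fps_const a * fps_X) * (1 - fps_const b * fps_X)
      = F - fps_const (a + b) * (fps_X * F) + fps_const (a * b) * (fps_X * (fps_X * F))"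
    by (simp add: algebra_simps flip: fps_const_add fps_const_mult)
  then have lhs1: "(F * (1 - fps_const a * fps_X) * (1 - fps_const b * fps_X)) $ 1
        = F $ 1 - (a + b) * F $ 0"
    and lhs2: "(F * (1 - fps_const a * fps_X) * (1 - fps_const b * fps_X)) $ Suc (Suc n)
        = F $ Suc (Suc n) - (a + b) * F $ Suc n + a * b * F $ n"
    by simp_all
  have rhs: "((1 + fps_const e * fps_X) * q3dilate F) $ m
      = fps_X ^ (3 * m) * F $ m + (if m = 0 then 0 else e * (fps_X ^ (3 * (m - 1)) * F $ (m - 1)))" for m
    by (simp add: distrib_right mult.assoc)
  have "F $ 1 - (a + b) * F $ 0 = fps_X ^ 3 * F $ 1 + e * F $ 0"
    using arg_cong[where f = "\<lambda>G. G $ 1", OF assms] unfolding lhs1 rhs by simp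
  then show "F $ 1 * (1 - fps_X ^ 3) = (a + b + e) * F $ 0"
    by (simp add: algebra_simps)
  have "F $ Suc (Suc n) - (a + b) * F $ Suc n + a * b * F $ n
      = fps_X ^ (3 * Suc (Suc n)) * F $ Suc (Suc n) + e * (fps_X ^ (3 * Suc n) * F $ Suc n)"
    using arg_cong[where f = "\<lambda>G. G $ Suc (Suc n)", OF assms] unfolding lhs2 rhs by simp
  then show "F $ Suc (Suc n) * (1 - fps_X ^ (3 * Suc (Suc n)))
      = (a + b + e * fps_X ^ (3 * Suc n)) * F $ Suc n - a * b * F $ n"
    by (simp add: algebra_simps)
qed

context
  fixes u v :: "'a::field"
begin

definition triple_qexp :: "'a fps fps" where
  "triple_qexp = qexp (fps_const u) * qexp (fps_const v * fps_X) * qExp (fps_const (u * v) * fps_X ^ 2)"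

lemma triple_qexp_functional_equation:
  "triple_qexp * (1 - fps_const (fps_const u) * fps_X) * (1 - fps_const (fps_const v * fps_X) * fps_X)
    = (1 + fps_const (fps_const (u * v) * fps_X ^ 2) * fps_X) * q3dilate triple_qexp"
proof -
  let ?A = "qexp (fps_const u)" and ?B = "qexp (fps_const v * fps_X)"
    and ?E = "qExp (fps_const (u * v) * fps_X ^ 2)"
  have "triple_qexp * (1 - fps_const (fps_const u) * fps_X) * (1 - fps_const (fps_const v * fps_X) * fps_X)
      = (?A * (1 - fps_const (fps_const u) * fps_X))
        * (?B * (1 - fps_const (fps_const v * fps_X) * fps_X)) * ?E"
    by (simp add: triple_qexp_def mult_ac)
  also have "\<dots> = q3dilate ?A * q3dilate ?B
                    * ((1 + fps_const (fps_const (u * v) * fps_X ^ 2) * fps_X) * q3dilate ?E)"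
    by (simp only: qexp_functional_equation qExp_functional_equation[symmetric])
  also have "\<dots> = (1 + fps_const (fps_const (u * v) * fps_X ^ 2) * fps_X) * q3dilate triple_qexp"
    by (simp only: triple_qexp_def q3dilate_mult mult_ac)
  finally show ?thesis .
qed

lemma triple_qexp_nth_0: "triple_qexp $ 0 = 1"
  by (simp add: triple_qexp_def qexp_def qExp_def)

lemma triple_qexp_nth_1: "triple_qexp $ 1 * (1 - fps_X ^ 3) = fps_const u + fps_const v * fps_X + fps_const (u * v) * fps_X ^ 2"
  using three_term_recurrence(1)[OF triple_qexp_functional_equation] by (simp add: triple_qexp_nth_0)

lemma triple_qexp_recurrence:
  "triple_qexp $ Suc (Suc n) * (1 - fps_X ^ (3 * n + 6))
    = (fps_const u + fps_const v * fps_X + fps_const (u * v) * fps_X ^ (3 * n + 5)) * triple_qexp $ Suc n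
      - fps_const (u * v) * fps_X * triple_qexp $ n"
  using three_term_recurrence(2)[OF triple_qexp_functional_equation, of n]
  by (simp add: power_add mult_ac)

end

section \<open>Base partitions\<close>

definition BS_step :: "nat \<Rightarrow> nat \<Rightarrow> bool" where
  "BS_step x y \<longleftrightarrow> (\<not> 3 dvd y \<longrightarrow> 3 \<le> y - x \<and> y - x \<le> 5) \<and> (3 dvd y \<longrightarrow> 4 \<le> y - x \<and> y - x \<le> 6)"

lemma BS_step_less: "BS_step x y \<Longrightarrow> x < y"
  unfolding BS_step_def by presburger

lemma BS_step_shift: "3 dvd d \<Longrightarrow> BS_step (x + d) (y + d) \<longleftrightarrow> BS_step x y"
  unfolding BS_step_def by presburger

lemma successively_BS_step_shift:
  "3 dvd d \<Longrightarrow> successively BS_step (map (\<lambda>z. z + d) xs) \<longleftrightarrow> successively BS_step xs"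
  by (simp add: successively_map BS_step_shift)

lemma in_BS_iff: "in_BS \<beta> \<longleftrightarrow> (\<beta> \<noteq> [] \<longrightarrow> hd \<beta> \<in> {1,2,3}) \<and> successively BS_step \<beta>"
proof
  assume h: "in_BS \<beta>"
  have "successively BS_step \<beta>"
    unfolding successively_conv_nth
  proof (intro allI impI)
    fix i assume "Suc i < length \<beta>"
    with h show "BS_step (\<beta> ! i) (\<beta> ! Suc i)"
      unfolding in_BS_def BS_step_def by (metis One_nat_def Suc_le_mono diff_Suc_1 le0)
  qed
  then show "(\<beta> \<noteq> [] \<longrightarrow> hd \<beta> \<in> {1,2,3}) \<and> successively BS_step \<beta>"
    using h unfolding in_BS_def by (simp add: hd_conv_nth)
next
  assume h: "(\<beta> \<noteq> [] \<longrightarrow> hd \<beta> \<in> {1,2,3}) \<and> successively BS_step \<beta>"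
  then have "successively (<) \<beta>"
    using successively_mono BS_step_less by blast
  then have sorted: "sorted_wrt (<) \<beta>"
    by (subst successively_conv_sorted_wrt[symmetric]) (auto simp: transp_def)
  have pos: "\<forall>x\<in>set \<beta>. 0 < x"
  proof (cases \<beta>)
    case (Cons a l)
    then show ?thesis
      using h sorted by fastforce
  qed simp
  have "BS_step (\<beta> ! (i - 1)) (\<beta> ! i)" if "1 \<le> i" "i < length \<beta>" for i
    using that h successively_nth[of BS_step \<beta> "i - 1"] by simp
  then show "in_BS \<beta>"
    unfolding in_BS_def BS_step_def
    using h pos strict_sorted_imp_sorted[OF sorted] by (auto simp: hd_conv_nth)
qed

lemma in_BS_nth_le:
  assumes "in_BS \<beta>" "i < length \<beta>"
  shows "\<beta> ! i \<le> 6 * i + 3"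
  using assms(2)
proof (induction i)
  case 0
  then show ?case
    using assms(1) by (auto simp: in_BS_def)
next
  case (Suc i)
  have "BS_step (\<beta> ! i) (\<beta> ! Suc i)"
    using assms(1) Suc.prems successively_nth[of BS_step \<beta> i] by (simp add: in_BS_iff)
  then have "\<beta> ! Suc i \<le> \<beta> ! i + 6"
    unfolding BS_step_def by presburger
  then show ?case
    using Suc by simp
qed

lemma finite_BS: "finite {\<beta>. in_BS \<beta> \<and> length \<beta> = n}"
proof (rule finite_subset)
  show "{\<beta>. in_BS \<beta> \<and> length \<beta> = n} \<subseteq> {xs. set xs \<subseteq> {..6 * n} \<and> length xs = n}"
    using in_BS_nth_le by (fastforce simp: in_set_conv_nth)
qed (rule finite_lists_length_eq, simp)

text \<open>
  A base partition starting with \<open>r\<close> continues with \<open>s + BS_gap r s\<close> for a unique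
  \<open>s \<in> {1,2,3}\<close>; the gap is the multiple of 3 that makes this a legal second part.
\<close>

definition BS_gap :: "nat \<Rightarrow> nat \<Rightarrow> nat" where
  "BS_gap r s = (if s < r \<or> (r = 3 \<and> s = 3) then 6 else 3)"

lemma BS_gap_dvd [simp]: "3 dvd BS_gap r s"
  by (simp add: BS_gap_def)

lemma BS_step_first_part:
  assumes "r \<in> {1,2,3}"
  shows "BS_step r y \<longleftrightarrow> (\<exists>s\<in>{1,2,3}. y = s + BS_gap r s)"
  using assms unfolding BS_step_def BS_gap_def by (elim insertE; simp; presburger)

lemma BS_gap_inj:
  "r \<in> {1,2,3} \<Longrightarrow> s \<in> {1,2,3} \<Longrightarrow> s' \<in> {1,2,3} \<Longrightarrow> s + BS_gap r s = s' + BS_gap r s' \<Longrightarrow> s = s'"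
  unfolding BS_gap_def by auto

definition BS_first :: "nat \<Rightarrow> nat \<Rightarrow> nat list set" where
  "BS_first n r = {\<beta>. in_BS \<beta> \<and> length \<beta> = n \<and> hd \<beta> = r}"

lemma finite_BS_first: "finite (BS_first n r)"
  unfolding BS_first_def by (rule finite_subset[OF _ finite_BS[of n]]) auto

lemma BS_first_length_1: "r \<in> {1,2,3} \<Longrightarrow> BS_first 1 r = {[r]}"
  by (auto simp: BS_first_def in_BS_iff length_Suc_conv)

lemma BS_length_Suc_eq_Un:
  "{\<beta>. in_BS \<beta> \<and> length \<beta> = Suc m} = BS_first (Suc m) 1 \<union> BS_first (Suc m) 2 \<union> BS_first (Suc m) 3"
  by (auto simp: BS_first_def in_BS_iff)

lemma shifted_Cons_in_BS_first:
  assumes r: "r \<in> {1,2,3}" and s: "s \<in> {1,2,3}" and xs: "xs \<in> BS_first (Suc m) s"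
  shows "r # map (\<lambda>z. z + BS_gap r s) xs \<in> BS_first (Suc (Suc m)) r"
proof -
  obtain ys where ys: "xs = s # ys"
    using xs by (cases xs) (auto simp: BS_first_def)
  have "BS_step r (s + BS_gap r s)"
    using BS_step_first_part[OF r] s by blast
  moreover have "successively BS_step (map (\<lambda>z. z + BS_gap r s) xs)"
    using xs successively_BS_step_shift[of "BS_gap r s" xs] by (simp add: BS_first_def in_BS_iff)
  ultimately have "successively BS_step (r # map (\<lambda>z. z + BS_gap r s) xs)"
    by (simp add: ys)
  then show ?thesis
    using xs r by (simp add: BS_first_def in_BS_iff)
qed

lemma BS_first_Suc_Suc_decompose:
  assumes r: "r \<in> {1,2,3}" and \<beta>: "\<beta> \<in> BS_first (Suc (Suc m)) r"
  obtains s xs where "s \<in> {1,2,3}" "xs \<in> BS_first (Suc m) s" "\<beta> = r # map (\<lambda>z. z + BS_gap r s) xs"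
proof -
  obtain y ys where \<beta>_eq: "\<beta> = r # y # ys" and succ: "successively BS_step (r # y # ys)"
    using \<beta> by (auto simp: BS_first_def in_BS_iff length_Suc_conv)
  then have "BS_step r y"
    by simp
  then obtain s where s: "s \<in> {1,2,3}" and y: "y = s + BS_gap r s"
    using BS_step_first_part[OF r] by blast
  define d where "d = BS_gap r s"
  have "successively BS_step (y # ys)"
    using succ by simp
  then have "successively (<) (y # ys)"
    by (rule successively_mono) (simp add: BS_step_less)
  then have "sorted_wrt (<) (y # ys)"
    by (subst successively_conv_sorted_wrt[symmetric]) (auto simp: transp_def)
  then have "\<forall>z\<in>set (y # ys). d \<le> z"
    using y by (auto simp: d_def)
  then have unshift: "map (\<lambda>z. z + d) (map (\<lambda>z. z - d) (y # ys)) = y # ys"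
    unfolding map_map comp_def by (intro map_idI) auto
  have "successively BS_step (map (\<lambda>z. z - d) (y # ys))"
    using succ unshift successively_BS_step_shift[of d "map (\<lambda>z. z - d) (y # ys)"] by (simp add: d_def)
  moreover have "length ys = m"
    using \<beta> \<beta>_eq by (simp add: BS_first_def)
  ultimately have "map (\<lambda>z. z - d) (y # ys) \<in> BS_first (Suc m) s"
    using s by (simp add: BS_first_def in_BS_iff y d_def)
  moreover have "\<beta> = r # map (\<lambda>z. z + BS_gap r s) (map (\<lambda>z. z - d) (y # ys))"
    using \<beta>_eq unshift by (simp only: d_def)
  ultimately show ?thesis
    using s that by blast
qed

lemma BS_first_Suc_Suc_eq_image:
  assumes r: "r \<in> {1,2,3}"
  shows "BS_first (Suc (Suc m)) r
           = (\<lambda>(s, xs). r # map (\<lambda>z. z + BS_gap r s) xs) ` (SIGMA s:{1,2,3}. BS_first (Suc m) s)"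
proof (intro equalityI subsetI)
  fix \<beta>
  assume "\<beta> \<in> BS_first (Suc (Suc m)) r"
  then obtain s xs where "s \<in> {1,2,3}" "xs \<in> BS_first (Suc m) s" "\<beta> = r # map (\<lambda>z. z + BS_gap r s) xs"
    using BS_first_Suc_Suc_decompose[OF r] by blast
  then show "\<beta> \<in> (\<lambda>(s, xs). r # map (\<lambda>z. z + BS_gap r s) xs) ` (SIGMA s:{1,2,3}. BS_first (Suc m) s)"
    by (intro rev_image_eqI[of "(s, xs)"]) auto
next
  fix \<beta>
  assume "\<beta> \<in> (\<lambda>(s, xs). r # map (\<lambda>z. z + BS_gap r s) xs) ` (SIGMA s:{1,2,3}. BS_first (Suc m) s)"
  then obtain s xs where "s \<in> {1,2,3}" "xs \<in> BS_first (Suc m) s" "\<beta> = r # map (\<lambda>z. z + BS_gap r s) xs"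
    by auto
  then show "\<beta> \<in> BS_first (Suc (Suc m)) r"
    using shifted_Cons_in_BS_first[OF r] by blast
qed

lemma inj_on_shifted_Cons:
  assumes r: "r \<in> {1,2,3}"
  shows "inj_on (\<lambda>(s, xs). r # map (\<lambda>z. z + BS_gap r s) xs) (SIGMA s:{1,2,3}. BS_first (Suc m) s)"
proof (rule inj_onI, clarify)
  have hd_shift: "hd (map (\<lambda>z. z + BS_gap r s) xs) = s + BS_gap r s" if "xs \<in> BS_first (Suc m) s" for s xs
    using that by (cases xs) (auto simp: BS_first_def)
  fix s xs s' xs'
  assume s: "s \<in> {1,2,3}" "xs \<in> BS_first (Suc m) s" and s': "s' \<in> {1,2,3}" "xs' \<in> BS_first (Suc m) s'"
    and eq: "map (\<lambda>z. z + BS_gap r s) xs = map (\<lambda>z. z + BS_gap r s') xs'"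
  have "hd (map (\<lambda>z. z + BS_gap r s) xs) = hd (map (\<lambda>z. z + BS_gap r s') xs')"
    using eq by (rule arg_cong)
  then have "s + BS_gap r s = s' + BS_gap r s'"
    by (simp only: hd_shift[OF s(2)] hd_shift[OF s'(2)])
  then have "s = s'"
    using BS_gap_inj[OF r s(1) s'(1)] by blast
  moreover from eq this have "map (\<lambda>z. z + BS_gap r s) xs = map (\<lambda>z. z + BS_gap r s) xs'"
    by simp
  then have "xs = xs'"
    by (rule map_injective) (simp add: inj_def)
  ultimately show "s = s' \<and> xs = xs'"
    by blast
qed

section \<open>Generating functions of base partitions\<close>

lemma closed_form_step:
  fixes x z p l a b c0 c1 c2 :: "'a::comm_ring_1"
  assumes "c2 * (1 - z * x ^ 6) = (a + b * x + a * b * (z * x ^ 5)) * c1 - a * b * x * c0"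
  shows "z * x ^ 3 * (a * x + b * x ^ 2 + a * b * (z * x ^ 6)) * (p * (1 - z * x ^ 3) * (z * x * l) * c1)
           - a * b * (z * z * x ^ 6) * (1 - z * x ^ 3) * (p * l * c0)
         = p * (1 - z * x ^ 3) * (1 - z * x ^ 6) * (z * z * x ^ 5 * l) * c2"
proof -
  have "z * x ^ 3 * (a * x + b * x ^ 2 + a * b * (z * x ^ 6)) * (p * (1 - z * x ^ 3) * (z * x * l) * c1)
           - a * b * (z * z * x ^ 6) * (1 - z * x ^ 3) * (p * l * c0)
      = p * (1 - z * x ^ 3) * (z * z * x ^ 5 * l) * ((a + b * x + a * b * (z * x ^ 5)) * c1 - a * b * x * c0)"
    by (simp add: algebra_simps eval_nat_numeral)
  also have "\<dots> = p * (1 - z * x ^ 3) * (1 - z * x ^ 6) * (z * z * x ^ 5 * l) * c2"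
    unfolding assms[symmetric] by (simp only: mult_ac)
  finally show ?thesis .
qed

context
  fixes u v :: "'a::field"
begin

definition part_weight :: "nat \<Rightarrow> 'a" where
  "part_weight x = (if x mod 3 = 1 then u else if x mod 3 = 2 then v else u * v)"

text \<open>Stated with \<open>Suc 0\<close>, the simp normal form of the numeral \<open>1 :: nat\<close>.\<close>
lemma part_weight_123 [simp]:
  "part_weight (Suc 0) = u" "part_weight 2 = v" "part_weight 3 = u * v"
  by (simp_all add: part_weight_def)

definition partition_weight :: "nat list \<Rightarrow> 'a fps" where
  "partition_weight \<beta> = fps_const (u ^ cnt_a \<beta> * v ^ cnt_c \<beta>) * fps_X ^ sum_list \<beta>"

lemma partition_weight_Nil [simp]: "partition_weight [] = 1"
  by (simp add: partition_weight_def cnt_a_def cnt_c_def)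

lemma part_weight_Cons:
  "u ^ cnt_a (x # \<beta>) * v ^ cnt_c (x # \<beta>) = part_weight x * (u ^ cnt_a \<beta> * v ^ cnt_c \<beta>)"
proof -
  have "x mod 3 = 0 \<or> x mod 3 = 1 \<or> x mod 3 = 2"
    by presburger
  then show ?thesis
    by (elim disjE) (simp_all add: cnt_a_def cnt_c_def part_weight_def mult_ac)
qed

lemma partition_weight_Cons:
  "partition_weight (x # \<beta>) = fps_const (part_weight x) * fps_X ^ x * partition_weight \<beta>"
  by (simp add: partition_weight_def part_weight_Cons power_add mult_ac flip: fps_const_mult)

lemma partition_weight_shift:
  assumes "3 dvd d"
  shows "partition_weight (map (\<lambda>z. z + d) \<beta>) = fps_X ^ (d * length \<beta>) * partition_weight \<beta>"
proof (induction \<beta>)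
  case (Cons x \<beta>)
  have "(x + d) mod 3 = x mod 3"
    using assms by presburger
  then have "part_weight (x + d) = part_weight x"
    by (simp add: part_weight_def)
  with Cons show ?case
    by (simp add: partition_weight_Cons power_add mult_ac)
qed simp

lemma bS_eq_sum: "bS u v n = (\<Sum>\<beta> | in_BS \<beta> \<and> length \<beta> = n. partition_weight \<beta>)"
proof (rule fps_ext)
  fix N
  have "(\<Sum>\<beta> | in_BS \<beta> \<and> length \<beta> = n. partition_weight \<beta>) $ N
      = (\<Sum>\<beta> | in_BS \<beta> \<and> length \<beta> = n. if sum_list \<beta> = N then u ^ cnt_a \<beta> * v ^ cnt_c \<beta> else 0)"
    by (auto simp: fps_sum_nth partition_weight_def intro!: sum.cong)
  also have "\<dots> = (\<Sum>\<beta>\<in>{\<beta> \<in> {\<beta>. in_BS \<beta> \<and> length \<beta> = n}. sum_list \<beta> = N}. u ^ cnt_a \<beta> * v ^ cnt_c \<beta>)"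
    by (rule sum.inter_filter[OF finite_BS, symmetric])
  also have "{\<beta> \<in> {\<beta>. in_BS \<beta> \<and> length \<beta> = n}. sum_list \<beta> = N}
      = {\<beta>. in_BS \<beta> \<and> length \<beta> = n \<and> sum_list \<beta> = N}"
    by auto
  finally show "bS u v n $ N = (\<Sum>\<beta> | in_BS \<beta> \<and> length \<beta> = n. partition_weight \<beta>) $ N"
    by (simp add: bS_def)
qed

definition gf_first :: "nat \<Rightarrow> nat \<Rightarrow> 'a fps" where
  "gf_first n r = (\<Sum>\<beta>\<in>BS_first n r. partition_weight \<beta>)"

lemma bS_0: "bS u v 0 = 1"
proof -
  have "{\<beta>. in_BS \<beta> \<and> length \<beta> = 0} = {[]}"
    by (auto simp: in_BS_def)
  then show ?thesis
    by (simp add: bS_eq_sum)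
qed

lemma bS_Suc: "bS u v (Suc m) = gf_first (Suc m) 1 + gf_first (Suc m) 2 + gf_first (Suc m) 3"
proof -
  have "BS_first (Suc m) 1 \<inter> BS_first (Suc m) 2 = {}"
    "(BS_first (Suc m) 1 \<union> BS_first (Suc m) 2) \<inter> BS_first (Suc m) 3 = {}"
    by (auto simp: BS_first_def)
  then show ?thesis
    unfolding bS_eq_sum BS_length_Suc_eq_Un gf_first_def
    by (simp add: sum.union_disjoint finite_BS_first)
qed

lemma gf_first_length_1:
  assumes "r \<in> {1,2,3}"
  shows "gf_first 1 r = fps_const (part_weight r) * fps_X ^ r"
  unfolding gf_first_def BS_first_length_1[OF assms] by (simp add: partition_weight_Cons)

lemma gf_first_Suc_Suc:
  assumes r: "r \<in> {1,2,3}"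
  shows "gf_first (Suc (Suc m)) r = fps_const (part_weight r) * fps_X ^ r *
           (\<Sum>s\<in>{1,2,3}. fps_X ^ (BS_gap r s * Suc m) * gf_first (Suc m) s)"
proof -
  let ?g = "\<lambda>(s, xs). r # map (\<lambda>z. z + BS_gap r s) xs"
  have "inj_on ?g (SIGMA s:{1,2,3}. BS_first (Suc m) s)"
    using inj_on_shifted_Cons[OF r] .
  then have "gf_first (Suc (Suc m)) r = sum (partition_weight \<circ> ?g) (SIGMA s:{1,2,3}. BS_first (Suc m) s)"
    unfolding gf_first_def BS_first_Suc_Suc_eq_image[OF r] by (rule sum.reindex)
  also have "\<dots> = (\<Sum>s\<in>{1,2,3}. \<Sum>xs\<in>BS_first (Suc m) s. partition_weight (r # map (\<lambda>z. z + BS_gap r s) xs))"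
    by (subst sum.Sigma) (simp_all add: finite_BS_first comp_def split_def)
  also have "\<dots> = (\<Sum>s\<in>{1,2,3}. \<Sum>xs\<in>BS_first (Suc m) s.
      fps_const (part_weight r) * fps_X ^ r * (fps_X ^ (BS_gap r s * Suc m) * partition_weight xs))"
    by (intro sum.cong refl)
       (simp add: partition_weight_Cons partition_weight_shift BS_first_def mult.assoc)
  also have "\<dots> = fps_const (part_weight r) * fps_X ^ r *
           (\<Sum>s\<in>{1,2,3}. fps_X ^ (BS_gap r s * Suc m) * gf_first (Suc m) s)"
    by (simp only: gf_first_def sum_distrib_left)
  finally show ?thesis .
qed

lemma gf_first_part_1: "gf_first (Suc m) 1 = fps_const u * fps_X ^ (3 * m + 1) * bS u v m"
proof (cases m)
  case 0
  then show ?thesis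
    using gf_first_length_1[where r = 1] by (simp add: bS_0)
next
  case (Suc k)
  have "gf_first (Suc (Suc k)) 1
      = fps_const u * fps_X ^ 1 * (\<Sum>s\<in>{1,2,3}. fps_X ^ (3 * Suc k) * gf_first (Suc k) s)"
    using gf_first_Suc_Suc[where r = 1 and m = k] by (simp add: BS_gap_def)
  also have "\<dots> = fps_const u * fps_X ^ 1 * (fps_X ^ (3 * Suc k) * bS u v (Suc k))"
    by (simp add: bS_Suc algebra_simps)
  finally show ?thesis
    using Suc by (simp add: power_add mult_ac eval_nat_numeral)
qed

lemma gf_first_part_3: "gf_first (Suc m) 3 = fps_const (u * v) * fps_X ^ (6 * m + 3) * bS u v m"
proof (cases m)
  case 0
  then show ?thesis
    using gf_first_length_1[where r = 3] by (simp add: bS_0)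
next
  case (Suc k)
  have "gf_first (Suc (Suc k)) 3
      = fps_const (u * v) * fps_X ^ 3 * (\<Sum>s\<in>{1,2,3}. fps_X ^ (6 * Suc k) * gf_first (Suc k) s)"
    using gf_first_Suc_Suc[where r = 3 and m = k] by (simp add: BS_gap_def)
  also have "\<dots> = fps_const (u * v) * fps_X ^ 3 * (fps_X ^ (6 * Suc k) * bS u v (Suc k))"
    by (simp add: bS_Suc algebra_simps)
  finally show ?thesis
    using Suc by (simp add: power_add mult_ac)
qed

lemma gf_first_part_2:
  "gf_first (Suc (Suc m)) 2 = fps_const v * fps_X ^ 2 *
     (fps_X ^ (6 * m + 6) * gf_first (Suc m) 1 + fps_X ^ (3 * m + 3) * (bS u v (Suc m) - gf_first (Suc m) 1))"
  by (simp add: gf_first_Suc_Suc bS_Suc BS_gap_def algebra_simps)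

lemma bS_1: "bS u v 1 = fps_const u * fps_X + fps_const v * fps_X ^ 2 + fps_const (u * v) * fps_X ^ 3"
  using bS_Suc[of 0] gf_first_length_1[where r = 1] gf_first_length_1[where r = 2] gf_first_length_1[where r = 3]
  by simp

lemma bS_recurrence:
  "bS u v (Suc (Suc m))
     = fps_X ^ (3 * m + 3) * (fps_const u * fps_X + fps_const v * fps_X ^ 2 + fps_const (u * v) * fps_X ^ (3 * m + 6))
         * bS u v (Suc m)
       - fps_const (u * v) * fps_X ^ (6 * m + 6) * (1 - fps_X ^ (3 * m + 3)) * bS u v m"
proof -
  define z where "z = (fps_X ^ (3 * m) :: 'a fps)"
  have p3: "fps_X ^ (3 * m + k) = z * fps_X ^ k" for k
    by (simp add: z_def power_add)
  have p6: "fps_X ^ (6 * m + k) = z * z * fps_X ^ k" for k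
    by (simp add: z_def flip: power_add)
  have F1: "gf_first (Suc (Suc m)) 1 = fps_const u * fps_X ^ (3 * m + 4) * bS u v (Suc m)"
    and F3: "gf_first (Suc (Suc m)) 3 = fps_const (u * v) * fps_X ^ (6 * m + 9) * bS u v (Suc m)"
    using gf_first_part_1[of "Suc m"] gf_first_part_3[of "Suc m"]
    by (simp_all add: algebra_simps)
  show ?thesis
    unfolding bS_Suc[of "Suc m"] F1 F3 gf_first_part_2 gf_first_part_1[of m] p3 p6
    by (simp add: algebra_simps eval_nat_numeral flip: fps_const_mult)
qed

lemma bS_closed_form: "bS u v n = q3poch n * fps_X ^ (n + 3 * tri n) * triple_qexp u v $ n"
proof (induction n rule: induct_nat_012)
  case 0
  then show ?case
    by (simp add: bS_0 triple_qexp_nth_0)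
next
  case 1
  have "bS u v 1 = fps_X * (triple_qexp u v $ 1 * (1 - fps_X ^ 3))"
    unfolding bS_1 triple_qexp_nth_1 by (simp add: algebra_simps eval_nat_numeral)
  then show ?case
    by (simp add: q3poch_def mult_ac)
next
  case (ge2 n)
  define z p l where "z = (fps_X ^ (3 * n) :: 'a fps)" and "p = (q3poch n :: 'a fps)"
    and "l = (fps_X ^ (n + 3 * tri n) :: 'a fps)"
  let ?a = "fps_const u" and ?b = "fps_const v"
  have p3: "fps_X ^ (3 * n + k) = z * fps_X ^ k" for k
    by (simp add: z_def power_add)
  have p6: "fps_X ^ (6 * n + k) = z * z * fps_X ^ k" for k
    by (simp add: z_def flip: power_add)
  have e1: "Suc n + 3 * tri (Suc n) = 3 * n + 1 + (n + 3 * tri n)"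
    and e2: "Suc (Suc n) + 3 * tri (Suc (Suc n)) = 6 * n + 5 + (n + 3 * tri n)"
    by simp_all
  have l1: "fps_X ^ (Suc n + 3 * tri (Suc n)) = z * fps_X * l"
    by (simp only: e1 power_add[of _ "3 * n + 1"] p3 l_def power_one_right)
  have l2: "fps_X ^ (Suc (Suc n) + 3 * tri (Suc (Suc n))) = z * z * fps_X ^ 5 * l"
    by (simp only: e2 power_add[of _ "6 * n + 5"] p6 l_def)
  have "3 * Suc n = 3 * n + 3" "3 * Suc (Suc n) = 3 * n + 6"
    by simp_all
  then have q1: "q3poch (Suc n) = p * (1 - z * fps_X ^ 3)"
    and q2: "q3poch (Suc (Suc n)) = p * (1 - z * fps_X ^ 3) * (1 - z * fps_X ^ 6)"
    by (simp_all only: q3poch_Suc p_def p3)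
  have IH0: "bS u v n = p * l * triple_qexp u v $ n"
    and IH1: "bS u v (Suc n) = p * (1 - z * fps_X ^ 3) * (z * fps_X * l) * triple_qexp u v $ Suc n"
    using ge2.IH by (simp_all only: p_def l_def q1 l1)
  have rec: "triple_qexp u v $ Suc (Suc n) * (1 - z * fps_X ^ 6)
      = (?a + ?b * fps_X + ?a * ?b * (z * fps_X ^ 5)) * triple_qexp u v $ Suc n - ?a * ?b * fps_X * triple_qexp u v $ n"
    using triple_qexp_recurrence[of u v n] by (simp only: p3 fps_const_mult)
  have "bS u v (Suc (Suc n))
      = z * fps_X ^ 3 * (?a * fps_X + ?b * fps_X ^ 2 + ?a * ?b * (z * fps_X ^ 6)) * bS u v (Suc n)
        - ?a * ?b * (z * z * fps_X ^ 6) * (1 - z * fps_X ^ 3) * bS u v n"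
    using bS_recurrence[of n] by (simp only: p3 p6 fps_const_mult)
  also have "\<dots> = p * (1 - z * fps_X ^ 3) * (1 - z * fps_X ^ 6) * (z * z * fps_X ^ 5 * l) * triple_qexp u v $ Suc (Suc n)"
    unfolding IH0 IH1 by (rule closed_form_step[OF rec])
  finally show ?case
    by (simp only: q2 l2)
qed

end

section \<open>Regrouping by the q-Chu-Vandermonde identity\<close>

lemma tri_exponent_identity:
  assumes "k \<le> m" "k \<le> l"
  shows "(m + l - k + 3 * tri (m + l - k)) + (l - k) + (2 * k + 3 * tri k)
       = (m + 3 * tri m) + (l + (l + 3 * tri l)) + 3 * ((m - k) * (l - k))"
proof -
  obtain a b where ab: "m = k + a" "l = k + b"
    using assms le_Suc_ex by blast
  then have "m + l - k = k + a + b"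
    by simp
  then show ?thesis
    unfolding ab by (simp add: tri_add algebra_simps)
qed

lemma sum_triple_convolution:
  "(\<Sum>n\<le>(N::nat). \<Sum>p=0..n. \<Sum>i=0..p. T i (p - i) (n - p)) = (\<Sum>(i, j, k) | i + j + k \<le> N. T i j k)"
proof -
  have "(\<Sum>n\<le>N. \<Sum>p=0..n. \<Sum>i=0..p. T i (p - i) (n - p))
      = (\<Sum>n\<le>N. \<Sum>(p, i)\<in>(SIGMA p:{0..n}. {0..p}). T i (p - i) (n - p))"
    by (intro sum.cong refl sum.Sigma) auto
  also have "\<dots> = (\<Sum>(n, p, i)\<in>(SIGMA n:{..N}. SIGMA p:{0..n}. {0..p}). T i (p - i) (n - p))"
    by (subst sum.Sigma) (auto simp: case_prod_beta)
  also have "\<dots> = (\<Sum>(i, j, k) | i + j + k \<le> N. T i j k)"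
    by (rule sum.reindex_bij_witness[where j = "\<lambda>(n, p, i). (i, p - i, n - p)"
          and i = "\<lambda>(a, b, c). (a + b + c, a + b, a)"]) auto
  finally show ?thesis .
qed

lemma sum_square_min_reindex:
  "(\<Sum>m\<le>(N::nat). \<Sum>l\<le>N. \<Sum>k\<le>min m l. T (m - k) (l - k) k) = (\<Sum>(i, j, k) | i + k \<le> N \<and> j + k \<le> N. T i j k)"
proof -
  have "(\<Sum>m\<le>N. \<Sum>l\<le>N. \<Sum>k\<le>min m l. T (m - k) (l - k) k)
      = (\<Sum>m\<le>N. \<Sum>(l, k)\<in>(SIGMA l:{..N}. {..min m l}). T (m - k) (l - k) k)"
    by (intro sum.cong refl sum.Sigma) auto
  also have "\<dots> = (\<Sum>(m, l, k)\<in>(SIGMA m:{..N}. SIGMA l:{..N}. {..min m l}). T (m - k) (l - k) k)"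
    by (subst sum.Sigma) (auto simp: case_prod_beta)
  also have "\<dots> = (\<Sum>(i, j, k) | i + k \<le> N \<and> j + k \<le> N. T i j k)"
    by (rule sum.reindex_bij_witness[where j = "\<lambda>(m, l, k). (m - k, l - k, k)"
          and i = "\<lambda>(a, b, c). (a + c, b + c, c)"]) auto
  finally show ?thesis .
qed

context
  fixes u v :: "'a::field"
begin

lemma qexp_u_nth: "qexp (fps_const u) $ i = fps_const (u ^ i) * q3inv i"
  by (simp add: qexp_def)

lemma qexp_vX_nth: "qexp (fps_const v * fps_X) $ j = fps_const (v ^ j) * fps_X ^ j * q3inv j"
  by (simp add: qexp_def power_mult_distrib)

lemma qExp_uvX2_nth:
  "qExp (fps_const (u * v) * fps_X ^ 2) $ k = fps_const ((u * v) ^ k) * fps_X ^ (2 * k + 3 * tri k) * q3inv k"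
  by (simp add: qExp_def power_mult_distrib power_add mult.assoc flip: power_mult)

definition triple_term :: "nat \<Rightarrow> nat \<Rightarrow> nat \<Rightarrow> 'a fps" where
  "triple_term i j k = fps_X ^ (i + j + k + 3 * tri (i + j + k)) * qexp (fps_const u) $ i
     * qexp (fps_const v * fps_X) $ j * qExp (fps_const (u * v) * fps_X ^ 2) $ k"

lemma triple_term_diagonal:
  assumes k: "k \<le> min m l"
  shows "triple_term (m - k) (l - k) k
       = fps_const (u ^ m * v ^ l) * fps_X ^ ((m + 3 * tri m) + (l + (l + 3 * tri l)))
         * (fps_X ^ (3 * ((m - k) * (l - k))) * q3inv (m - k) * q3inv (l - k) * q3inv k)"
proof -
  have c: "u ^ (m - k) * v ^ (l - k) * (u * v) ^ k = u ^ m * v ^ l"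
    using k by (simp add: power_mult_distrib mult_ac flip: power_add)
  have "m - k + (l - k) + k = m + l - k"
    using k by simp
  then have e: "fps_X ^ (m - k + (l - k) + k + 3 * tri (m - k + (l - k) + k)) * fps_X ^ (l - k) * fps_X ^ (2 * k + 3 * tri k)
      = fps_X ^ ((m + 3 * tri m) + (l + (l + 3 * tri l))) * (fps_X ^ (3 * ((m - k) * (l - k))) :: 'a fps)"
    using tri_exponent_identity[of k m l] k by (simp only: power_add[symmetric])
  have "triple_term (m - k) (l - k) k
      = (fps_const (u ^ (m - k)) * fps_const (v ^ (l - k)) * fps_const ((u * v) ^ k))
        * (fps_X ^ (m - k + (l - k) + k + 3 * tri (m - k + (l - k) + k)) * fps_X ^ (l - k) * fps_X ^ (2 * k + 3 * tri k))
        * (q3inv (m - k) * q3inv (l - k) * q3inv k)"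
    unfolding triple_term_def qexp_u_nth qexp_vX_nth qExp_uvX2_nth by (simp only: mult_ac)
  also have "\<dots> = fps_const (u ^ m * v ^ l) * fps_X ^ ((m + 3 * tri m) + (l + (l + 3 * tri l)))
         * (fps_X ^ (3 * ((m - k) * (l - k))) * q3inv (m - k) * q3inv (l - k) * q3inv k)"
    unfolding e fps_const_mult c by (simp only: mult_ac)
  finally show ?thesis .
qed

lemma qexp_product_vandermonde:
  "fps_X ^ (m + 3 * tri m) * qexp (fps_const u) $ m * (fps_X ^ (l + 3 * tri l) * qexp (fps_const v * fps_X) $ l)
   = (\<Sum>k\<le>min m l. triple_term (m - k) (l - k) k)"
proof -
  let ?K = "fps_const (u ^ m * v ^ l) * fps_X ^ ((m + 3 * tri m) + (l + (l + 3 * tri l)))"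
  have "(\<Sum>k\<le>min m l. triple_term (m - k) (l - k) k)
      = ?K * (\<Sum>k\<le>min m l. fps_X ^ (3 * ((m - k) * (l - k))) * q3inv (m - k) * q3inv (l - k) * q3inv k)"
    by (simp add: triple_term_diagonal sum_distrib_left)
  also have "\<dots> = ?K * (q3inv m * q3inv l)"
    by (simp only: q_vandermonde_X3)
  also have "\<dots> = (fps_const (u ^ m) * fps_const (v ^ l))
      * (fps_X ^ (m + 3 * tri m) * (fps_X ^ (l + 3 * tri l) * fps_X ^ l)) * (q3inv m * q3inv l)"
    unfolding fps_const_mult
    by (simp only: power_add[symmetric] add.commute[of "l + 3 * tri l" l] mult_ac)
  also have "\<dots> = fps_X ^ (m + 3 * tri m) * qexp (fps_const u) $ m * (fps_X ^ (l + 3 * tri l) * qexp (fps_const v * fps_X) $ l)"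
    unfolding qexp_u_nth qexp_vX_nth by (simp only: mult_ac)
  finally show ?thesis ..
qed

lemma weighted_triple_qexp_sum_eq_triple_sum:
  "(\<Sum>n\<le>N. fps_X ^ (n + 3 * tri n) * triple_qexp u v $ n) = (\<Sum>(i, j, k) | i + j + k \<le> N. triple_term i j k)"
proof -
  have "fps_X ^ (n + 3 * tri n) * triple_qexp u v $ n = (\<Sum>p=0..n. \<Sum>i=0..p. triple_term i (p - i) (n - p))" for n
  proof -
    have "fps_X ^ (n + 3 * tri n) * triple_qexp u v $ n
        = (\<Sum>p=0..n. \<Sum>i=0..p. fps_X ^ (n + 3 * tri n) * (qexp (fps_const u) $ i
            * qexp (fps_const v * fps_X) $ (p - i) * qExp (fps_const (u * v) * fps_X ^ 2) $ (n - p)))"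
      by (simp add: triple_qexp_def fps_mult_nth sum_distrib_left sum_distrib_right)
    also have "\<dots> = (\<Sum>p=0..n. \<Sum>i=0..p. triple_term i (p - i) (n - p))"
      by (intro sum.cong refl) (auto simp: triple_term_def mult_ac)
    finally show ?thesis .
  qed
  then show ?thesis
    by (simp only: sum_triple_convolution[of triple_term N])
qed

lemma qexp_product_eq_triple_sum:
  "(\<Sum>m\<le>N. fps_X ^ (m + 3 * tri m) * qexp (fps_const u) $ m)
     * (\<Sum>l\<le>N. fps_X ^ (l + 3 * tri l) * qexp (fps_const v * fps_X) $ l)
   = (\<Sum>(i, j, k) | i + k \<le> N \<and> j + k \<le> N. triple_term i j k)"
  by (simp add: sum_product qexp_product_vandermonde sum_square_min_reindex[of triple_term N, symmetric])

lemma weighted_triple_qexp_sum_eq_upto_qexp_product: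
  "eq_upto N (\<Sum>n\<le>N. fps_X ^ (n + 3 * tri n) * triple_qexp u v $ n)
     ((\<Sum>m\<le>N. fps_X ^ (m + 3 * tri m) * qexp (fps_const u) $ m)
      * (\<Sum>l\<le>N. fps_X ^ (l + 3 * tri l) * qexp (fps_const v * fps_X) $ l))"
proof -
  let ?S = "{(i, j, k). i + j + k \<le> N}"
  let ?S' = "{(i, j, k). i + k \<le> N \<and> j + k \<le> N \<and> N < i + j + k}"
  have union: "?S \<union> ?S' = {(i, j, k). i + k \<le> N \<and> j + k \<le> N}"
    by auto
  have "eq_upto N (\<Sum>(i, j, k)\<in>?S \<union> ?S'. triple_term i j k) (\<Sum>(i, j, k)\<in>?S. triple_term i j k)"
  proof (rule eq_upto_sum_tail)
    show "finite ?S'"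
      by (rule finite_subset[of _ "{..N} \<times> {..N} \<times> {..N}"]) auto
    show "eq_upto N (case x of (i, j, k) \<Rightarrow> triple_term i j k) 0" if "x \<in> ?S'" for x
      using that by (auto simp: triple_term_def mult.assoc intro!: eq_upto_X_power_mult)
  qed auto
  then have "eq_upto N (\<Sum>(i, j, k) | i + k \<le> N \<and> j + k \<le> N. triple_term i j k)
      (\<Sum>(i, j, k) | i + j + k \<le> N. triple_term i j k)"
    by (simp only: union)
  then show ?thesis
    unfolding weighted_triple_qexp_sum_eq_triple_sum qexp_product_eq_triple_sum by (rule eq_upto_sym)
qed

lemma partial_sums_eq_upto:
  assumes "N < M"
  shows "eq_upto N (\<Sum>n<M. bS u v n * inverse (q3poch n))
     ((\<Sum>m\<le>N. fps_X ^ (m + 3 * tri m) * qexp (fps_const u) $ m)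
      * (\<Sum>l\<le>N. fps_X ^ (l + 3 * tri l) * qexp (fps_const v * fps_X) $ l))"
proof -
  have "(\<Sum>n<M. bS u v n * inverse (q3poch n)) = (\<Sum>n\<in>{..N} \<union> {N<..<M}. fps_X ^ (n + 3 * tri n) * triple_qexp u v $ n)"
  proof (rule sum.cong)
    show "{..<M} = {..N} \<union> {N<..<M}"
      using assms by auto
  qed (simp add: bS_closed_form mult_ac)
  moreover have "eq_upto N (\<Sum>n\<in>{..N} \<union> {N<..<M}. fps_X ^ (n + 3 * tri n) * triple_qexp u v $ n)
      (\<Sum>n\<le>N. fps_X ^ (n + 3 * tri n) * triple_qexp u v $ n)"
    by (rule eq_upto_sum_tail) (auto intro: eq_upto_X_power_mult)
  ultimately show ?thesis
    using eq_upto_trans[OF _ weighted_triple_qexp_sum_eq_upto_qexp_product] by simp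
qed

lemma partial_products_eq_upto:
  assumes "2 * N < M"
  shows "eq_upto N (\<Prod>j\<in>{1..M}. (1 + fps_const u * fps_X ^ (3 * j - 2)) * (1 + fps_const v * fps_X ^ (3 * j - 1)))
     ((\<Sum>m\<le>N. fps_X ^ (m + 3 * tri m) * qexp (fps_const u) $ m)
      * (\<Sum>l\<le>N. fps_X ^ (l + 3 * tri l) * qexp (fps_const v * fps_X) $ l))"
proof -
  have split: "(\<Prod>j\<in>{1..M}. (1 + fps_const u * fps_X ^ (3 * j - 2)) * (1 + fps_const v * fps_X ^ (3 * j - 1)))
      = (\<Prod>j<M. 1 + fps_const u * fps_X ^ (1 + 3 * j)) * (\<Prod>j<M. 1 + fps_const v * fps_X ^ (2 + 3 * j))"
    by (simp add: prod.atLeast1_atMost_eq prod.distrib)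
  have su: "(\<Sum>m\<le>N. fps_const (u ^ m) * fps_X ^ (1 * m + 3 * tri m) * q3inv m)
      = (\<Sum>m\<le>N. fps_X ^ (m + 3 * tri m) * qexp (fps_const u) $ m)"
    unfolding qexp_u_nth by (simp add: mult_ac)
  have sv: "(\<Sum>l\<le>N. fps_const (v ^ l) * fps_X ^ (2 * l + 3 * tri l) * q3inv l)
      = (\<Sum>l\<le>N. fps_X ^ (l + 3 * tri l) * qexp (fps_const v * fps_X) $ l)"
    unfolding qexp_vX_nth mult_2 power_add by (simp only: mult_ac)
  have "eq_upto N (\<Prod>j<M. 1 + fps_const u * fps_X ^ (1 + 3 * j))
      (\<Sum>m\<le>N. fps_const (u ^ m) * fps_X ^ (1 * m + 3 * tri m) * q3inv m)"
    and "eq_upto N (\<Prod>j<M. 1 + fps_const v * fps_X ^ (2 + 3 * j))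
      (\<Sum>l\<le>N. fps_const (v ^ l) * fps_X ^ (2 * l + 3 * tri l) * q3inv l)"
    using euler_truncation[of 1 N M u] euler_truncation[of 2 N M v] assms by simp_all
  from eq_upto_mult[OF this] show ?thesis
    unfolding split su sv .
qed

end

theorem theorem11:
  fixes u v :: "'a::field"
  shows "\<exists>L :: 'a fps.
     (\<lambda>m. \<Sum>n<m. bS u v n * inverse (q3poch n)) \<longlonglongrightarrow> L \<and>
     (\<lambda>m. \<Prod>j\<in>{1..m}. (1 + fps_const u * fps_X ^ (3 * j - 2)) *
                        (1 + fps_const v * fps_X ^ (3 * j - 1))) \<longlonglongrightarrow> L"
proof -
  define P where "P N = (\<Sum>m\<le>N. fps_X ^ (m + 3 * tri m) * qexp (fps_const u) $ m)
      * (\<Sum>l\<le>N. fps_X ^ (l + 3 * tri l) * qexp (fps_const v * fps_X) $ l)" for N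
  have "eventually (\<lambda>m. eq_upto N (\<Sum>n<m. bS u v n * inverse (q3poch n)) (P N)) sequentially" for N
    using eventually_gt_at_top[of N]
    by eventually_elim (unfold P_def, erule partial_sums_eq_upto)
  moreover have "eventually (\<lambda>m. eq_upto N (\<Prod>j\<in>{1..m}. (1 + fps_const u * fps_X ^ (3 * j - 2)) *
      (1 + fps_const v * fps_X ^ (3 * j - 1))) (P N)) sequentially" for N
    using eventually_gt_at_top[of "2 * N"]
    by eventually_elim (unfold P_def, erule partial_products_eq_upto)
  ultimately show ?thesis
    by (blast intro: tendsto_fps_eq_upto)
qed

end
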